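(* If $\operatorname{Homeo}(\mathbb N^{\mathbb N})$ is equipped with the pointwise topology, then it has precisely $2^{\aleph_0}$ open maximal subgroups.
   Context: $\operatorname{Homeo}(\mathbb N^{\mathbb N})$ is the group of all homeomorphisms of the Baire space $\mathbb N^{\mathbb N}$ (product topology, $\mathbb N$ discrete). The pointwise topology on it is the subspace topology inherited from $\operatorname{Sym}(\mathbb N^{\mathbb N})$, i.e. the topology generated by the sets $\{f : (x)f=y\}$ over all $x,y\in\mathbb N^{\mathbb N}$ (maps are written on the right). A proper subgroup $M$ of a group $G$ is maximal if there is no subgroup $H$ of $G$ with $M<H<G$. An open maximal subgroup is a maximal subgroup that is an open subset. *)

theory Defs
  imports "HOL-Analysis.Analysis" "HOL-Algebra.Group" "HOL-Library.Equipollence"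
begin

text \<open>
  The type \<^typ>\<open>nat \<Rightarrow> nat\<close> carries, as an instance of \<^class>\<open>topological_space\<close>, the product
  topology of the discrete topology on \<^typ>\<open>nat\<close>.
\<close>

type_synonym baire = "nat \<Rightarrow> nat"

definition homeos :: "('a::topological_space \<Rightarrow> 'a) set" where
  "homeos = {f. \<exists>g. homeomorphism UNIV UNIV f g}"

text \<open>Maps act on the right, so in the product of \<open>f\<close> and \<open>g\<close> the map \<open>f\<close> is applied first.\<close>

definition Homeo :: "('a::topological_space \<Rightarrow> 'a) monoid" where
  "Homeo = \<lparr>carrier = homeos, mult = (\<lambda>f g. g \<circ> f), one = id\<rparr>"

definition sym_pointwise_topology :: "('a \<Rightarrow> 'a) topology" where
  "sym_pointwise_topology = topology_generated_by {{f. bij f \<and> f x = y} | x y. True}"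

definition pointwise_topology :: "('a::topological_space \<Rightarrow> 'a) topology" where
  "pointwise_topology = subtopology sym_pointwise_topology (carrier Homeo)"

definition maximal_subgroup :: "'a set \<Rightarrow> ('a, 'b) monoid_scheme \<Rightarrow> bool" where
  "maximal_subgroup M G \<longleftrightarrow>
     subgroup M G \<and> M \<subset> carrier G \<and> \<not> (\<exists>H. subgroup H G \<and> M \<subset> H \<and> H \<subset> carrier G)"

lemma homeos_imp_bij: "f \<in> homeos \<Longrightarrow> bij f"
  unfolding homeos_def homeomorphism_def by (auto intro: o_bij simp: fun_eq_iff)

lemma homeomorphism_inverse:
  assumes "homeomorphism UNIV UNIV f g"
  shows "g \<in> homeos" "g \<circ> f = id" "f \<circ> g = id"
  using assms homeomorphism_sym
  unfolding homeos_def homeomorphism_def by (auto simp: fun_eq_iff)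

lemma group_Homeo: "group (Homeo :: ('a::topological_space \<Rightarrow> 'a) monoid)"
proof (rule groupI)
  show "f \<otimes>\<^bsub>Homeo\<^esub> g \<in> carrier Homeo" if "f \<in> carrier Homeo" "g \<in> carrier Homeo"
    for f g :: "'a \<Rightarrow> 'a"
    using that by (auto simp: Homeo_def homeos_def intro: homeomorphism_compose)
  show "\<one>\<^bsub>Homeo\<^esub> \<in> carrier (Homeo :: ('a \<Rightarrow> 'a) monoid)"
    unfolding Homeo_def homeos_def homeomorphism_def by (auto intro!: exI[of _ id])
  show "\<exists>g\<in>carrier Homeo. g \<otimes>\<^bsub>Homeo\<^esub> f = \<one>\<^bsub>Homeo\<^esub>" if "f \<in> carrier Homeo"
    for f :: "'a \<Rightarrow> 'a"
  proof -
    obtain g where "homeomorphism UNIV UNIV f g"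
      using \<open>f \<in> carrier Homeo\<close> by (auto simp: Homeo_def homeos_def)
    then show ?thesis
      by (intro bexI[of _ g]) (simp_all add: Homeo_def homeomorphism_inverse)
  qed
qed (auto simp: Homeo_def o_assoc)

lemma topspace_pointwise_topology: "topspace pointwise_topology = carrier Homeo"
  by (auto simp: pointwise_topology_def sym_pointwise_topology_def Homeo_def
      dest: homeos_imp_bij)

end

theory Submission
  imports Defs "HOL-Combinatorics.Transposition"
begin

text \<open>
  Pointwise stabilizers of finite sets \<open>C\<close> act transitively on the complement of \<open>C\<close>.
  Hence point stabilizers are maximal, which gives \<open>2\<^sup>\<aleph>\<^sup>0\<close> open maximal subgroups.
  Conversely, let \<open>M\<close> be a proper open subgroup and let \<open>F\<close> be a finite set of least size whose
  pointwise stabilizer lies in \<open>M\<close>. If some \<open>g \<in> M\<close> moved \<open>F\<close> to a set missing a point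
  \<open>a \<in> F\<close>, then \<open>M\<close>, containing the pointwise stabilizers of both \<open>F\<close> and its image, would contain
  that of \<open>F - {a}\<close>. So \<open>M\<close> lies in the setwise stabilizer of \<open>F\<close>, with equality if
  \<open>M\<close> is maximal, and there are only \<open>2\<^sup>\<aleph>\<^sup>0\<close> finite sets \<open>F\<close>.
\<close>

section \<open>The group of homeomorphisms\<close>

lemma homeos_id: "id \<in> homeos"
  unfolding homeos_def homeomorphism_def by (auto intro!: exI[of _ id])

lemma homeos_comp: "f \<in> homeos \<Longrightarrow> g \<in> homeos \<Longrightarrow> g \<circ> f \<in> homeos"
  by (auto simp: homeos_def intro: homeomorphism_compose)

lemma homeos_inv: "f \<in> homeos \<Longrightarrow> inv_into UNIV f \<in> homeos"
proof -
  assume "f \<in> homeos"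
  then obtain g where "homeomorphism UNIV UNIV f g"
    by (auto simp: homeos_def)
  then have "g \<in> homeos" "g \<circ> f = id" "f \<circ> g = id"
    by (rule homeomorphism_inverse)+
  then show "inv_into UNIV f \<in> homeos"
    by (metis inv_unique_comp)
qed

lemma homeos_inj: "f \<in> homeos \<Longrightarrow> inj f"
  by (simp add: bij_is_inj homeos_imp_bij)

lemma homeos_surj: "f \<in> homeos \<Longrightarrow> surj f"
  by (simp add: bij_is_surj homeos_imp_bij)

lemma inv_Homeo:
  assumes "f \<in> homeos"
  shows "inv\<^bsub>Homeo\<^esub> f = inv_into UNIV f"
proof (rule group.inv_equality[OF group_Homeo])
  show "inv_into UNIV f \<otimes>\<^bsub>Homeo\<^esub> f = \<one>\<^bsub>Homeo\<^esub>"
    using homeos_imp_bij[OF assms] by (simp add: Homeo_def fun_eq_iff bij_is_surj surj_f_inv_f)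
qed (use assms homeos_inv in \<open>auto simp: Homeo_def\<close>)

lemma subgroup_Homeo_iff:
  "subgroup M Homeo \<longleftrightarrow>
    M \<subseteq> homeos \<and> id \<in> M \<and> (\<forall>f\<in>M. \<forall>g\<in>M. g \<circ> f \<in> M) \<and> (\<forall>f\<in>M. inv_into UNIV f \<in> M)"
  (is "_ \<longleftrightarrow> ?R")
proof
  assume "subgroup M Homeo"
  then interpret subgroup M Homeo .
  have sub: "M \<subseteq> homeos"
    using subset by (simp add: Homeo_def)
  moreover have "inv_into UNIV f \<in> M" if "f \<in> M" for f
    using m_inv_closed[OF that] inv_Homeo that sub by (metis subsetD)
  ultimately show ?R
    using one_closed m_closed by (auto simp: Homeo_def)
next
  assume ?R
  then show "subgroup M Homeo"
    by unfold_locales (auto simp: Homeo_def inv_Homeo[unfolded Homeo_def])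
qed

lemma subgroup_HomeoD:
  assumes "subgroup M Homeo"
  shows "f \<in> M \<Longrightarrow> f \<in> homeos" "id \<in> M" "f \<in> M \<Longrightarrow> g \<in> M \<Longrightarrow> g \<circ> f \<in> M"
    "f \<in> M \<Longrightarrow> inv_into UNIV f \<in> M"
  using assms unfolding subgroup_Homeo_iff by blast+

text \<open>Serves to put \<open>f\<close> into \<open>M\<close>: once some \<open>m\<close> in
  \<open>M\<close> agrees with a homeomorphism \<open>f\<close> on a set whose pointwise stabilizer
  lies in \<open>M\<close>, the map \<open>inv_into UNIV m \<circ> f\<close> fixes that set
  pointwise.\<close>

lemma subgroup_Homeo_left_cancel:
  assumes M: "subgroup M Homeo" and "m \<in> M" and "inv_into UNIV m \<circ> f \<in> M"
  shows "f \<in> M"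
proof -
  have "m \<in> homeos"
    by (rule subgroup_HomeoD(1)[OF M \<open>m \<in> M\<close>])
  then have "m \<circ> (inv_into UNIV m \<circ> f) = f"
    by (simp add: fun_eq_iff homeos_surj surj_f_inv_f)
  then show ?thesis
    using subgroup_HomeoD(3)[OF M assms(3) \<open>m \<in> M\<close>] by simp
qed

definition pointwise_stab :: "'a set \<Rightarrow> ('a::topological_space \<Rightarrow> 'a) set" where
  "pointwise_stab F = {f \<in> homeos. \<forall>x\<in>F. f x = x}"

definition setwise_stab :: "'a set \<Rightarrow> ('a::topological_space \<Rightarrow> 'a) set" where
  "setwise_stab F = {f \<in> homeos. f ` F = F}"

lemma subgroup_setwise_stab: "subgroup (setwise_stab F) Homeo"
proof -
  have "inv_into UNIV f ` F = F" if "f \<in> homeos" "f ` F = F" for f :: "'a \<Rightarrow> 'a"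
    using that by (metis homeos_inj image_inv_f_f)
  moreover have "(g \<circ> f) ` F = F" if "f ` F = F" "g ` F = F" for f g :: "'a \<Rightarrow> 'a"
    by (simp only: image_comp[symmetric] that)
  ultimately show ?thesis
    by (simp add: subgroup_Homeo_iff setwise_stab_def homeos_id homeos_comp homeos_inv subset_iff)
qed

lemma pointwise_stab_singleton: "pointwise_stab {x} = setwise_stab {x}"
  by (simp add: pointwise_stab_def setwise_stab_def)

section \<open>Open subgroups\<close>

text \<open>Induction over the generation of \<open>S\<close>: a subbasic set constrains one value,
  and an intersection joins two finite sets. All generators consist of bijections, so
  \<open>g\<close> has to be one.\<close>

lemma openin_sym_pointwise_topology_agree:
  assumes "openin sym_pointwise_topology S" "f \<in> S"
  shows "\<exists>F. finite F \<and> (\<forall>g. bij g \<and> (\<forall>x\<in>F. g x = f x) \<longrightarrow> g \<in> S)"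
proof -
  have "generate_topology_on {{f. bij f \<and> f x = y} | x y. True} S"
    using assms(1) by (simp add: sym_pointwise_topology_def openin_topology_generated_by_iff)
  then show ?thesis
    using assms(2)
  proof (induction arbitrary: f)
    case (Int a b)
    then have "f \<in> a" "f \<in> b"
      by simp_all
    obtain A where "finite A" "\<forall>g. bij g \<and> (\<forall>x\<in>A. g x = f x) \<longrightarrow> g \<in> a"
      using Int.IH(1)[OF \<open>f \<in> a\<close>] by blast
    moreover obtain B where "finite B" "\<forall>g. bij g \<and> (\<forall>x\<in>B. g x = f x) \<longrightarrow> g \<in> b"
      using Int.IH(2)[OF \<open>f \<in> b\<close>] by blast
    ultimately show ?case
      by (intro exI[of _ "A \<union> B"]) auto
  next
    case (UN K)
    then obtain k where "k \<in> K" "f \<in> k"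
      by blast
    from UN.IH[OF this] show ?case
      using \<open>k \<in> K\<close> by blast
  next
    case (Basis s)
    then obtain x y where "s = {f. bij f \<and> f x = y}"
      by blast
    with Basis show ?case
      by (intro exI[of _ "{x}"]) auto
  qed simp
qed

lemma open_subgroup_contains_pointwise_stab:
  fixes M :: "('a::topological_space \<Rightarrow> 'a) set"
  assumes "subgroup M Homeo" "openin pointwise_topology M"
  obtains F where "finite F" "pointwise_stab F \<subseteq> M"
proof -
  obtain S where S: "openin sym_pointwise_topology S" "M = S \<inter> homeos"
    using assms(2) by (auto simp: pointwise_topology_def openin_subtopology Homeo_def)
  \<comment> \<open>\<open>M\<close> is a neighbourhood of \<open>id\<close>, and agreeing with
    \<open>id\<close> on \<open>F\<close> means fixing \<open>F\<close> pointwise.\<close>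
  moreover have "id \<in> M"
    by (rule subgroup_HomeoD(2)[OF assms(1)])
  ultimately obtain F where "finite F" "\<forall>g. bij g \<and> (\<forall>x\<in>F. g x = id x) \<longrightarrow> g \<in> S"
    by (metis IntD1 openin_sym_pointwise_topology_agree)
  then have "pointwise_stab F \<subseteq> M"
    using S by (auto simp: pointwise_stab_def homeos_imp_bij)
  with \<open>finite F\<close> show thesis
    by (rule that)
qed

lemma openin_pointwise_stab_singleton: "openin pointwise_topology (pointwise_stab {x})"
proof -
  have "openin sym_pointwise_topology {f. bij f \<and> f x = x}"
    unfolding sym_pointwise_topology_def by (rule topology_generated_by_Basis) blast
  moreover have "pointwise_stab {x} = {f. bij f \<and> f x = x} \<inter> carrier Homeo"
    by (auto simp: pointwise_stab_def Homeo_def homeos_imp_bij)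
  ultimately show ?thesis
    unfolding pointwise_topology_def openin_subtopology by blast
qed

section \<open>Maximal subgroups in the presence of transitive stabilizers\<close>

text \<open>Isolates the two properties of the space on which the classification rests. The dummy
  parameter \<open>space_type\<close> makes the type itself an argument of the locale.\<close>

locale transitive_stabilizers =
  fixes space_type :: "'a::topological_space itself"
  assumes infinite_UNIV: "infinite (UNIV :: 'a set)"
    and transitive: "\<lbrakk>finite C; x \<notin> C; y \<notin> C\<rbrakk> \<Longrightarrow> \<exists>h\<in>pointwise_stab C. h x = (y::'a)"
begin

lemma fresh_point:
  assumes "finite C"
  obtains y :: 'a where "y \<notin> C"
  using assms infinite_UNIV by (metis UNIV_I ex_new_if_finite)

lemma setwise_stab_proper:
  fixes F :: "'a set"
  assumes "finite F" "F \<noteq> {}"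
  shows "setwise_stab F \<subset> homeos"
proof -
  obtain x where "x \<in> F"
    using assms by blast
  obtain y where "y \<notin> F"
    using fresh_point assms by blast
  obtain h where "h \<in> homeos" "h x = y"
    using transitive[of "{}" x y] by (auto simp: pointwise_stab_def)
  then have "h \<notin> setwise_stab F"
    using \<open>x \<in> F\<close> \<open>y \<notin> F\<close> by (auto simp: setwise_stab_def)
  then show ?thesis
    using \<open>h \<in> homeos\<close> by (auto simp: setwise_stab_def)
qed

lemma maximal_subgroup_point_stab: "maximal_subgroup (pointwise_stab {x::'a}) Homeo"
proof -
  have "homeos \<subseteq> H" if H: "subgroup H Homeo" and less: "pointwise_stab {x} \<subset> H" for H
  proof
    fix g :: "'a \<Rightarrow> 'a"
    assume g: "g \<in> homeos"
    obtain h where h: "h \<in> H" "h x \<noteq> x"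
      using less H by (force simp: subgroup_Homeo_iff pointwise_stab_def)
    \<comment> \<open>By left cancellation, \<open>g\<close> lies in \<open>H\<close> once some
      member of \<open>H\<close> sends \<open>x\<close> where \<open>g\<close> does.\<close>
    obtain m where m: "m \<in> H" "m x = g x"
    proof (cases "g x = x")
      case True
      then show thesis
        using that[of id] H by (simp add: subgroup_Homeo_iff)
    next
      case False
      \<comment> \<open>Both \<open>h x\<close> and \<open>g x\<close> differ from \<open>x\<close>,
        so a map fixing \<open>x\<close> can carry one to the other.\<close>
      then obtain k where "k \<in> pointwise_stab {x}" "k (h x) = g x"
        using transitive[of "{x}" "h x" "g x"] h by auto
      then show thesis
        using that[of "k \<circ> h"] less h H by (auto simp: subgroup_Homeo_iff)
    qed
    then have "m \<in> homeos"
      using subgroup_HomeoD(1)[OF H] by blast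
    then have "inv_into UNIV m \<circ> g \<in> pointwise_stab {x}"
      using g m by (auto simp: pointwise_stab_def homeos_comp homeos_inv inv_f_eq homeos_inj)
    then show "g \<in> H"
      using subgroup_Homeo_left_cancel[OF H m(1)] less by blast
  qed
  moreover have "subgroup (pointwise_stab {x}) Homeo" "pointwise_stab {x} \<subset> homeos"
    by (simp_all add: pointwise_stab_singleton subgroup_setwise_stab setwise_stab_proper)
  moreover have "carrier Homeo = (homeos :: ('a \<Rightarrow> 'a) set)"
    by (simp add: Homeo_def)
  ultimately show ?thesis
    unfolding maximal_subgroup_def by (metis psubsetE)
qed

text \<open>If \<open>x \<noteq> y\<close>, the stabilizer of \<open>x\<close> still moves
  \<open>y\<close> to a third point.\<close>

lemma inj_point_stab: "inj (\<lambda>x::'a. pointwise_stab {x})"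
proof (rule injI)
  fix x y :: 'a
  assume eq: "pointwise_stab {x} = pointwise_stab {y}"
  show "x = y"
  proof (rule ccontr)
    assume "x \<noteq> y"
    obtain z where "z \<notin> {x, y}"
      using fresh_point[of "{x, y}"] by blast
    then obtain h where "h \<in> pointwise_stab {x}" "h y = z"
      using transitive[of "{x}" y z] \<open>x \<noteq> y\<close> by auto
    then show False
      using eq \<open>z \<notin> {x, y}\<close> by (auto simp: pointwise_stab_def)
  qed
qed

section \<open>Open maximal subgroups as setwise stabilizers of finite sets\<close>

lemma pointwise_stab_remove_point:
  fixes M :: "('a \<Rightarrow> 'a) set"
  assumes M: "subgroup M Homeo" and A: "finite A" "pointwise_stab A \<subseteq> M"
    and B: "finite B" "pointwise_stab B \<subseteq> M" and a: "a \<in> A" "a \<notin> B"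
  shows "pointwise_stab (A - {a}) \<subseteq> M"
proof
  fix h
  assume h: "h \<in> pointwise_stab (A - {a})"
  then have "h \<in> homeos" "inj h"
    by (auto simp: pointwise_stab_def homeos_inj)
  \<comment> \<open>Such an \<open>m\<close> agrees with \<open>h\<close> on all of
    \<open>A\<close>, which suffices by left cancellation.\<close>
  have "\<exists>m\<in>M. m a = h a \<and> (\<forall>x\<in>A - {a}. m x = x)"
  proof (cases "h a = a")
    case True
    then show ?thesis
      using M by (auto simp: subgroup_Homeo_iff intro!: bexI[of _ id])
  next
    case False
    then have "h a \<notin> A"
      using h \<open>inj h\<close> by (auto simp: pointwise_stab_def dest!: injD[of h "h a" a])
    \<comment> \<open>The point \<open>a\<close> travels to \<open>h a\<close> through a fresh
      \<open>b\<close>: first by a map fixing \<open>B\<close> and \<open>A - {a}\<close>, then by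
      one fixing \<open>A\<close>. Each factor lies in \<open>M\<close>.\<close>
    obtain b where b: "b \<notin> A \<union> B"
      using fresh_point A B by (metis finite_Un)
    then obtain k where k: "k \<in> pointwise_stab (B \<union> (A - {a}))" "k a = b"
      using transitive[of "B \<union> (A - {a})" a b] A B a by auto
    obtain k' where k': "k' \<in> pointwise_stab A" "k' b = h a"
      using transitive[of A b "h a"] A b \<open>h a \<notin> A\<close> by auto
    have "k \<in> M" "k' \<in> M"
      using k k' A B by (auto simp: pointwise_stab_def)
    then have "k' \<circ> k \<in> M"
      by (intro subgroup_HomeoD(3)[OF M])
    then show ?thesis
      using k k' by (intro bexI[of _ "k' \<circ> k"]) (auto simp: pointwise_stab_def)
  qed
  then obtain m where m: "m \<in> M" "m a = h a" "\<forall>x\<in>A - {a}. m x = x"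
    by blast
  then have "m \<in> homeos"
    using subgroup_HomeoD(1)[OF M] by blast
  then have "inv_into UNIV m \<circ> h \<in> homeos"
    using \<open>h \<in> homeos\<close> by (simp add: homeos_comp homeos_inv)
  moreover have "m x = h x" if "x \<in> A" for x
    using m h that by (cases "x = a") (auto simp: pointwise_stab_def)
  ultimately have "inv_into UNIV m \<circ> h \<in> pointwise_stab A"
    using \<open>m \<in> homeos\<close> by (auto simp: pointwise_stab_def inv_f_eq homeos_inj)
  then show "h \<in> M"
    using subgroup_Homeo_left_cancel[OF M m(1)] A by blast
qed

text \<open>Conjugation by \<open>g\<close> carries the pointwise stabilizer of \<open>F\<close> to
  that of its image.\<close>

lemma pointwise_stab_image:
  fixes M :: "('a \<Rightarrow> 'a) set"
  assumes M: "subgroup M Homeo" and "pointwise_stab F \<subseteq> M" "g \<in> M"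
  shows "pointwise_stab (g ` F) \<subseteq> M"
proof
  fix h
  assume h: "h \<in> pointwise_stab (g ` F)"
  have g: "g \<in> homeos" "inv_into UNIV g \<in> M"
    using subgroup_HomeoD[OF M] \<open>g \<in> M\<close> by blast+
  then have "inv_into UNIV g \<circ> (h \<circ> g) \<in> pointwise_stab F"
    using h by (auto simp: pointwise_stab_def homeos_comp homeos_inv homeos_inj inv_f_eq)
  then have "h \<circ> g \<in> M"
    using subgroup_Homeo_left_cancel[OF M \<open>g \<in> M\<close>] assms(2) by blast
  then have "(h \<circ> g) \<circ> inv_into UNIV g \<in> M"
    by (rule subgroup_HomeoD(3)[OF M g(2)])
  moreover have "(h \<circ> g) \<circ> inv_into UNIV g = h"
    using g by (simp add: fun_eq_iff homeos_surj surj_f_inv_f)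
  ultimately show "h \<in> M"
    by simp
qed

lemma open_maximal_subgroup_setwise_stab:
  fixes M :: "('a \<Rightarrow> 'a) set"
  assumes max: "maximal_subgroup M Homeo" and "openin pointwise_topology M"
  obtains F where "finite F" "F \<noteq> {}" "M = setwise_stab F"
proof -
  have M: "subgroup M Homeo" and "M \<subset> homeos"
    using max by (auto simp: maximal_subgroup_def Homeo_def)
  let ?P = "\<lambda>F. finite F \<and> pointwise_stab F \<subseteq> M"
  obtain F0 where "?P F0"
    using open_subgroup_contains_pointwise_stab M assms(2) by blast
  then obtain F where F: "?P F" and least: "\<And>C. ?P C \<Longrightarrow> card F \<le> card C"
    using ex_has_least_nat[of ?P F0 card] by blast
  \<comment> \<open>The pointwise stabilizer of \<open>{}\<close> is the whole group, while
    \<open>M\<close> is proper.\<close>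
  have "F \<noteq> {}"
    using F \<open>M \<subset> homeos\<close> by (auto simp: pointwise_stab_def)
  have "M \<subseteq> setwise_stab F"
  proof
    fix g
    assume "g \<in> M"
    then have g: "g \<in> homeos"
      using \<open>M \<subset> homeos\<close> by blast
    have "F \<subseteq> g ` F"
    proof (rule ccontr)
      assume "\<not> F \<subseteq> g ` F"
      then obtain a where a: "a \<in> F" "a \<notin> g ` F"
        by blast
      \<comment> \<open>The image of \<open>F\<close> under \<open>g\<close> serves as the second
        set, the one that misses \<open>a\<close>.\<close>
      have "?P (F - {a})"
        using pointwise_stab_remove_point[OF M _ _ _ pointwise_stab_image[OF M _ \<open>g \<in> M\<close>] a] F
        by blast
      then have "card F \<le> card (F - {a})"
        by (rule least)
      then show False
        using F a by (metis card_Diff1_less linorder_not_le)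
    qed
    \<comment> \<open>For finite sets of equal size, one inclusion forces equality.\<close>
    moreover have "card (g ` F) = card F"
      using g by (meson card_image homeos_inj inj_on_subset subset_UNIV)
    ultimately have "g ` F = F"
      using F by (metis card_subset_eq finite_imageI)
    then show "g \<in> setwise_stab F"
      using g by (simp add: setwise_stab_def)
  qed
  then have "M = setwise_stab F"
    using max setwise_stab_proper[of F] subgroup_setwise_stab[of F] F \<open>F \<noteq> {}\<close>
    by (auto simp: maximal_subgroup_def Homeo_def)
  then show thesis
    using that F \<open>F \<noteq> {}\<close> by blast
qed

end

section \<open>Baire space\<close>

lemma clopen_cylinder:
  fixes x :: baire
  shows "open {z. \<forall>i<n. z i = x i}" "closed {z. \<forall>i<n. z i = x i}"
proof -
  have eq: "{z. \<forall>i<n. z i = x i} = (\<Inter>i\<in>{..<n}. (\<lambda>z. z i) -` {x i})"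
    by auto
  have cont: "continuous_on UNIV (\<lambda>z::baire. z i)" for i
    by (rule continuous_on_product_coordinates)
  show "open {z. \<forall>i<n. z i = x i}"
    unfolding eq by (intro open_INT finite_lessThan ballI open_vimage cont open_discrete)
  show "closed {z. \<forall>i<n. z i = x i}"
    unfolding eq by (intro closed_INT ballI closed_vimage cont) simp
qed

text \<open>Provides a cylinder around \<open>x\<close> that misses \<open>C\<close>: its length
  exceeds one chosen index of disagreement for each of the finitely many \<open>c\<close>.\<close>

lemma baire_separating_prefix:
  fixes x :: baire
  assumes "finite C" "x \<notin> C"
  obtains n where "\<And>c. c \<in> C \<Longrightarrow> \<exists>i<n. c i \<noteq> x i"
proof -
  have "\<forall>c\<in>C. \<exists>i. c i \<noteq> x i"
    using assms by (metis ext)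
  then obtain d where d: "\<forall>c\<in>C. c (d c) \<noteq> x (d c)"
    by metis
  have "d c < Suc (Max (d ` C))" if "c \<in> C" for c
    using that assms by (simp add: less_Suc_eq_le)
  then show thesis
    using d that by blast
qed

text \<open>
  Swapping the values \<open>x i\<close> and \<open>y i\<close> in every coordinate \<open>i\<close> exchanges \<open>x\<close> and \<open>y\<close> as well as their
  cylinders; restricting this involution to small cylinders leaves \<open>C\<close> fixed.
\<close>

lemma baire_transitive:
  fixes x y :: baire
  assumes "finite C" "x \<notin> C" "y \<notin> C"
  shows "\<exists>h\<in>pointwise_stab C. h x = y"
proof -
  obtain m where m: "\<And>c. c \<in> C \<Longrightarrow> \<exists>i<m. c i \<noteq> x i"
    using baire_separating_prefix assms(1,2) by blast
  obtain n where n: "\<And>c. c \<in> C \<Longrightarrow> \<exists>i<n. c i \<noteq> y i"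
    using baire_separating_prefix assms(1,3) by blast
  define N where "N = max m n"
  define U where "U = {z. \<forall>i<N. z i = x i} \<union> {z. \<forall>i<N. z i = y i}"
  define \<phi> where "\<phi> z i = Transposition.transpose (x i) (y i) (z i)" for z :: baire and i
  define h where "h z = (if z \<in> U then \<phi> z else z)" for z
  have U: "open U" "closed U"
    unfolding U_def by (intro open_Un closed_Un clopen_cylinder)+
  have "c \<notin> U" if "c \<in> C" for c
    using m[OF that] n[OF that] unfolding U_def N_def by (force simp: less_max_iff_disj)
  then have fix_C: "\<forall>c\<in>C. h c = c"
    by (simp add: h_def)
  \<comment> \<open>Since \<open>\<phi>\<close> preserves \<open>U\<close>, the map \<open>h\<close>
    is an involution, hence its own inverse.\<close>
  have "\<phi> z \<in> U" if "z \<in> U" for z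
    using that by (auto simp: U_def \<phi>_def)
  moreover have "\<phi> (\<phi> z) = z" for z
    by (simp add: \<phi>_def fun_eq_iff)
  ultimately have invol: "h (h z) = z" for z
    by (simp add: h_def)
  have "continuous_on UNIV \<phi>"
  proof (rule continuous_on_coordinatewise_then_product)
    fix i
    have "continuous_on UNIV (Transposition.transpose (x i) (y i) \<circ> (\<lambda>z::baire. z i))"
      by (intro continuous_on_compose continuous_on_product_coordinates)
        (rule Topological_Spaces.continuous_on_discrete)
    then show "continuous_on UNIV (\<lambda>z. \<phi> z i)"
      by (simp add: \<phi>_def o_def)
  qed
  \<comment> \<open>As \<open>U\<close> is clopen, \<open>h\<close> is glued from
    \<open>\<phi>\<close> and the identity on two closed pieces.\<close>
  then have "continuous_on (U \<union> - U) h"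
    unfolding h_def using U
    by (intro continuous_on_cases) (auto intro: continuous_on_subset)
  then have "homeomorphism UNIV UNIV h h"
    by (simp add: homeomorphism_def invol) (metis invol surjI)
  then have "h \<in> pointwise_stab C"
    using fix_C by (auto simp: pointwise_stab_def homeos_def)
  moreover have "h x = y"
    by (simp add: h_def U_def \<phi>_def fun_eq_iff)
  ultimately show ?thesis
    by blast
qed

section \<open>Counting the open maximal subgroups\<close>

lemma baire_eqpoll_Pow_nat: "(UNIV :: baire set) \<approx> Pow (UNIV :: nat set)"
proof (rule lepoll_antisym)
  \<comment> \<open>A function is recovered from its graph, coded as a set of numbers.\<close>
  have "inj (\<lambda>f::baire. {prod_encode (n, f n) | n. True})"
  proof (rule injI)
    fix f g :: baire
    assume "{prod_encode (n, f n) | n. True} = {prod_encode (n, g n) | n. True}"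
    then have "\<exists>k. prod_encode (n, f n) = prod_encode (k, g k)" for n
      by blast
    then show "f = g"
      by (auto simp: fun_eq_iff)
  qed
  then show "(UNIV :: baire set) \<lesssim> Pow (UNIV :: nat set)"
    unfolding lepoll_def by blast
  have "inj (\<lambda>A n. of_bool (n \<in> A) :: nat)"
    by (rule injI) (simp add: fun_eq_iff set_eq_iff of_bool_eq_iff)
  then show "Pow (UNIV :: nat set) \<lesssim> (UNIV :: baire set)"
    unfolding lepoll_def by auto
qed

text \<open>Row \<open>k\<close> of \<open>z\<close> is the \<open>k\<close>-th point in an
  enumeration of \<open>F\<close> with repetitions, which exists because \<open>F\<close> is
  nonempty. This bounds the number of such sets by the size of Baire space.\<close>

lemma finite_baire_set_coded:
  fixes F :: "baire set"
  assumes "finite F" "F \<noteq> {}"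
  obtains z :: baire where "F = range (\<lambda>k i. z (prod_encode (k, i)))"
proof -
  have "F = range (from_nat_into F)"
    using assms by (simp add: countable_finite range_from_nat_into)
  then show thesis
    using that[of "\<lambda>j. case prod_decode j of (k, i) \<Rightarrow> from_nat_into F k i"] by simp
qed

interpretation baire: transitive_stabilizers "TYPE(baire)"
proof
  show "infinite (UNIV :: baire set)"
    using baire_eqpoll_Pow_nat eqpoll_finite_iff by (metis finite_Pow_iff infinite_UNIV_nat)
qed (rule baire_transitive)

theorem mainTheorem5:
  shows "{M :: (baire \<Rightarrow> baire) set. maximal_subgroup M Homeo \<and> openin pointwise_topology M}
           \<approx> Pow (UNIV :: nat set)"
proof -
  let ?\<M> = "{M :: (baire \<Rightarrow> baire) set. maximal_subgroup M Homeo \<and> openin pointwise_topology M}"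
  have "?\<M> \<approx> (UNIV :: baire set)"
  proof (rule lepoll_antisym)
    let ?S = "\<lambda>z::baire. setwise_stab (range (\<lambda>k i. z (prod_encode (k, i))))"
    \<comment> \<open>An inclusion is enough for the upper bound; some \<open>z\<close> code
      infinite sets.\<close>
    have "?\<M> \<subseteq> range ?S"
    proof
      fix M
      assume "M \<in> ?\<M>"
      then obtain F where "finite F" "F \<noteq> {}" "M = setwise_stab F"
        using baire.open_maximal_subgroup_setwise_stab by blast
      then obtain z where "M = ?S z"
        using finite_baire_set_coded by metis
      then show "M \<in> range ?S"
        by (rule range_eqI[of M ?S z])
    qed
    then show "?\<M> \<lesssim> (UNIV :: baire set)"
      by (rule lepoll_trans[OF subset_imp_lepoll image_lepoll])
    show "(UNIV :: baire set) \<lesssim> ?\<M>"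
      unfolding lepoll_def
      by (intro exI[of _ "\<lambda>x. pointwise_stab {x}"] conjI baire.inj_point_stab)
        (simp add: image_subset_iff baire.maximal_subgroup_point_stab openin_pointwise_stab_singleton)
  qed
  then show ?thesis
    using baire_eqpoll_Pow_nat by (rule eqpoll_trans)
qed

end
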